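(* Let $S(\mathbb Z_{18})$ be the set of integer group determinants of the cyclic group $\mathbb Z_{18}$ (equivalently, of $18\times 18$ integer circulant determinants). Let $D$ be an integer that is not of the form $3^3m$ with $3\nmid m$. Then $D\in S(\mathbb Z_{18})$ if and only if $D$ is of one of the forms: $m$ with $\gcd(m,6)=1$; $2^2m$ with $\gcd(m,3)=1$; $3^4(2m+1)$ with $m\in\mathbb Z$; $2^2\cdot 3^4 m$ with $m\in\mathbb Z$.
   Context: For a finite group $G$ and $\sum_{g\in G}a_g g\in\mathbb Z[G]$, its group determinant is $\det\left(a_{gh^{-1}}\right)_{g,h\in G}$; $S(G)$ denotes the set of all such values with integer $a_g$. *)

theory Defs
  imports "HOL-Analysis.Determinants" "HOL-Library.Numeral_Type"
begin

text \<open>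
  A finite group is given by a type of class \<^class>\<open>finite\<close> and \<^class>\<open>group_add\<close> (not necessarily
  commutative, but written additively), so that the entry at index \<open>g h\<^sup>-\<^sup>1\<close> is \<open>a (g - h)\<close>.
\<close>

definition group_determinant :: "('g::{finite, group_add} \<Rightarrow> int) \<Rightarrow> int"
  where "group_determinant a = det (\<chi> g h. a (g - h))"

text \<open>
  The type argument stands for the group. The cyclic group of order 18 is the numeral type \<open>18\<close>,
  whose addition is addition modulo 18.
\<close>

definition integer_group_determinants :: "'g::{finite, group_add} itself \<Rightarrow> int set"
  where "integer_group_determinants _ = range (group_determinant :: ('g \<Rightarrow> int) \<Rightarrow> int)"

end

theory Submission
  imports Defs "HOL-Number_Theory.Cong"
begin

text \<open>
  The discrete Fourier transform turns the determinant of \<open>F \<in> \<int>[\<int>\<^sub>1\<^sub>8]\<close> into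
  \<open>\<Prod>\<^sub>k F(\<zeta>\<^sup>k)\<close>. Writing \<open>18 = 2 \<cdot> 9\<close>, the even and the odd \<open>k\<close> contribute the
  \<open>\<int>\<^sub>9\<close>-determinants of two elements \<open>f\<close> and \<open>g\<close> that are congruent modulo 2, so an even
  determinant is divisible by 4. A \<open>\<int>\<^sub>9\<close>-determinant is a product of norms from
  \<open>\<rat>\<close>, \<open>\<rat>(\<omega>)\<close> and \<open>\<rat>(\<zeta>\<^sub>9)\<close>, each of which is modulo 3 a power of the augmentation
  (3 is totally ramified), so if one of them is divisible by 3, then all are, and 27 divides
  the determinant. Conversely, adding a multiple of the sum of all group elements changes the norm
  from \<open>\<rat>\<close> of \<open>f\<close> only; this moves four kinds of explicit elements, built from cyclotomic units,
  through all the values claimed.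
\<close>

section \<open>Group determinants of cyclic groups via the discrete Fourier transform\<close>

lemma det_of_int:
  "det (\<chi> i j. of_int (M i j)) = (of_int (det (\<chi> i j. M i j)) :: 'a::comm_ring_1)"
  by (simp add: det_def)

lemma power_cong_mod:
  fixes z :: "'a::monoid_mult"
  assumes "z ^ n = 1" and "[i = j] (mod n)"
  shows "z ^ i = z ^ j"
proof -
  have "z ^ i = z ^ (i mod n)" for i
  proof -
    have "z ^ i = z ^ (n * (i div n) + i mod n)"
      by simp
    also have "\<dots> = z ^ (i mod n)"
      by (simp only: power_add power_mult assms(1) power_one mult_1)
    finally show ?thesis .
  qed
  then show ?thesis
    using assms(2) by (metis cong_def)
qed

lemma sum_powers_root_of_unity:
  fixes y :: "'a::field"
  assumes "y ^ n = 1" and "y \<noteq> 1"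
  shows "(\<Sum>m<n. y ^ m) = 0"
  using assms geometric_sum[of y n] by simp

text \<open>The rows of the Fourier matrix \<open>V\<close> are left eigenvectors of
  \<open>A\<close> with eigenvalues \<open>c (r k)\<close>. Orthogonality of characters makes
  \<open>V ** W\<close> equal to \<open>n\<close> times the identity, so \<open>det V\<close> is
  nonzero and cancels.\<close>

lemma group_determinant_cyclic:
  fixes a :: "'g::{finite, group_add} \<Rightarrow> int" and r :: "'g \<Rightarrow> nat" and z :: "'a::field_char_0"
  assumes bij: "bij_betw r UNIV {..<n}"
    and hom: "\<And>g h. [r (g + h) = r g + r h] (mod n)"
    and root: "z ^ n = 1"
    and primitive: "\<And>k. 0 < k \<Longrightarrow> k < n \<Longrightarrow> z ^ k \<noteq> 1"
  shows "of_int (group_determinant a) = (\<Prod>k<n. \<Sum>g\<in>UNIV. of_int (a g) * z ^ (k * r g))"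
proof -
  have r_less: "r g < n" for g
    using bij by (auto simp: bij_betw_def)
  have n: "n > 0"
    using r_less[of undefined] by simp
  have z: "z \<noteq> 0"
    using root n by (metis power_0_left zero_neq_one less_irrefl)
  define V where "V = (\<chi> (g::'g) (h::'g). z ^ (r g * r h))"
  define W where "W = (\<chi> (g::'g) (h::'g). inverse z ^ (r g * r h))"
  define A where "A = (\<chi> (g::'g) (h::'g). (of_int (a (g - h)) :: 'a))"
  define c where "c k = (\<Sum>g\<in>UNIV. of_int (a g) * z ^ (k * r g))" for k
  have VW: "(V ** W) $ k $ l = (if k = l then of_nat n else 0)" for k l
  proof -
    define y where "y = z ^ r k * inverse z ^ r l"
    have yn: "y ^ n = 1"
      unfolding y_def power_mult_distrib
      by (metis inverse_1 mult.right_neutral power_commuting_commutes power_inverse power_mult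
          power_mult_distrib power_one root mult.commute)
    have "(V ** W) $ k $ l = (\<Sum>g\<in>UNIV. y ^ r g)"
      by (simp add: V_def W_def matrix_matrix_mult_def y_def power_mult_distrib power_mult
          mult.commute flip: power_mult)
    also have "\<dots> = (\<Sum>m<n. y ^ m)"
      by (rule sum.reindex_bij_betw[OF bij])
    also have "\<dots> = (if k = l then of_nat n else 0)"
    proof (cases "k = l")
      case True
      then have "y = 1"
        using z by (simp add: y_def power_inverse)
      then show ?thesis
        using True by simp
    next
      case False
      then have neq: "r k \<noteq> r l"
        using bij by (auto simp: bij_betw_def inj_on_def)
      have ne: "z ^ i \<noteq> z ^ j" if "i < j" "j < n" for i j
      proof
        assume "z ^ i = z ^ j"
        then have "z ^ (j - i) = 1"
          using z that by (simp add: power_diff)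
        then show False
          using primitive[of "j - i"] that by simp
      qed
      have "z ^ r k \<noteq> z ^ r l"
        using neq ne r_less by (metis linorder_neqE_nat)
      then have "y \<noteq> 1"
        using z by (simp add: y_def power_inverse field_simps)
      then show ?thesis
        using sum_powers_root_of_unity[OF yn] False by simp
    qed
    finally show ?thesis .
  qed
  have "det V * det W = (\<Prod>k\<in>UNIV. (V ** W) $ k $ k)"
    unfolding det_mul[symmetric] by (rule det_diagonal) (simp add: VW)
  then have "det V * det W \<noteq> 0"
    using n by (simp add: VW)
  then have V: "det V \<noteq> 0"
    by auto
  have "(V ** A) $ k $ h = c (r k) * V $ k $ h" for k h
  proof -
    have "(V ** A) $ k $ h = (\<Sum>g\<in>UNIV. z ^ (r k * r g) * of_int (a (g - h)))"
      by (simp add: V_def A_def matrix_matrix_mult_def)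
    also have "\<dots> = (\<Sum>g\<in>UNIV. z ^ (r k * r (g + h)) * of_int (a g))"
      by (rule sum.reindex_bij_witness[of _ "\<lambda>g. g + h" "\<lambda>g. g - h"]) auto
    also have "\<dots> = (\<Sum>g\<in>UNIV. z ^ (r k * r g) * of_int (a g) * z ^ (r k * r h))"
    proof (rule sum.cong)
      fix g
      have "z ^ (r k * r (g + h)) = z ^ (r k * (r g + r h))"
        by (intro power_cong_mod[OF root] cong_mult hom cong_refl)
      then show "z ^ (r k * r (g + h)) * of_int (a g)
          = z ^ (r k * r g) * of_int (a g) * z ^ (r k * r h)"
        by (simp add: distrib_left power_add)
    qed simp
    also have "\<dots> = c (r k) * V $ k $ h"
      by (simp add: c_def V_def sum_distrib_left sum_distrib_right mult_ac)
    finally show ?thesis .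
  qed
  then have VA: "V ** A = (\<chi> k. c (r k) *s (V $ k))"
    by (simp add: vec_eq_iff)
  have "det V * det A = (\<Prod>k\<in>UNIV. c (r k)) * det V"
    using det_rows_mul[of "\<lambda>k. c (r k)" "\<lambda>k. V $ k"] by (simp add: VA flip: det_mul)
  then have "det A = (\<Prod>k\<in>UNIV. c (r k))"
    using V by simp
  also have "\<dots> = (\<Prod>k<n. c k)"
    by (rule prod.reindex_bij_betw[OF bij])
  finally show ?thesis
    by (simp add: A_def c_def group_determinant_def det_of_int)
qed

text \<open>Provides the hypotheses \<open>bij\<close> and \<open>hom\<close> of
  \<open>group_determinant_cyclic\<close> for the standard residues.\<close>

lemma bit0_index:
  fixes r :: "'n::finite bit0 \<Rightarrow> nat"
  defines "r \<equiv> \<lambda>g. nat (Rep_bit0 g)"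
  shows "bij_betw r UNIV {..<CARD('n bit0)}" "[r (g + h) = r g + r h] (mod CARD('n bit0))"
proof -
  have nonneg: "0 \<le> Rep_bit0 g" and less: "Rep_bit0 g < int CARD('n bit0)" for g :: "'n bit0"
    using type_definition.Rep[OF type_definition_bit0, of g] by auto
  show "bij_betw r UNIV {..<CARD('n bit0)}"
  proof (rule bij_betwI)
    show "r \<in> UNIV \<rightarrow> {..<CARD('n bit0)}"
      using nonneg less by (auto simp: r_def nat_less_iff simp del: card_bit0)
    show "Abs_bit0 \<circ> int \<in> {..<CARD('n bit0)} \<rightarrow> UNIV"
      by simp
    show "(Abs_bit0 \<circ> int) (r g) = g" for g
      using nonneg by (simp add: r_def bit0.Rep_inverse)
    show "r ((Abs_bit0 \<circ> int) k) = k" if "k \<in> {..<CARD('n bit0)}" for k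
      using that by (simp add: r_def bit0.Abs_inverse)
  qed
  have "int (r (g + h)) = (int (r g) + int (r h)) mod int CARD('n bit0)"
    using nonneg by (simp add: r_def bit0.add_def bit0.Rep_Abs_mod del: card_bit0)
  then show "[r (g + h) = r g + r h] (mod CARD('n bit0))"
    by (metis cong_def mod_mod_trivial of_nat_add of_nat_eq_iff of_nat_mod)
qed

section \<open>Eisenstein integers and norms at ninth roots of unity\<close>

text \<open>The pair \<open>(a, b)\<close> stands for the Eisenstein integer \<open>a + b \<omega>\<close>.\<close>

fun eis_mult :: "int \<times> int \<Rightarrow> int \<times> int \<Rightarrow> int \<times> int"
  where "eis_mult (a, b) (c, d) = (a * c - b * d, a * d + b * c - b * d)"

fun eis_norm :: "int \<times> int \<Rightarrow> int"
  where "eis_norm (a, b) = a\<^sup>2 - a * b + b\<^sup>2"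

fun eis :: "'a::comm_ring_1 \<Rightarrow> int \<times> int \<Rightarrow> 'a"
  where "eis w (a, b) = of_int a + of_int b * w"

text \<open>
  This is \<open>A\<^sup>3 + \<omega> B\<^sup>3 + \<omega>\<^sup>2 C\<^sup>3 - 3 \<omega> A B C\<close>, the norm of \<open>A + B \<zeta> + C \<zeta>\<^sup>2\<close> from
  \<open>\<rat>(\<zeta>)\<close> to \<open>\<rat>(\<omega>)\<close>, where \<open>\<zeta>\<^sup>3 = \<omega>\<close>.
\<close>

definition eis_cubic :: "int \<times> int \<Rightarrow> int \<times> int \<Rightarrow> int \<times> int \<Rightarrow> int \<times> int"
  where "eis_cubic A B C = eis_mult A (eis_mult A A) + eis_mult (0, 1) (eis_mult B (eis_mult B B))
    + eis_mult (- 1, - 1) (eis_mult C (eis_mult C C)) - eis_mult (0, 3) (eis_mult A (eis_mult B C))"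

text \<open>
  The norms of \<open>\<Sum>\<^sub>j c\<^sub>j x\<^sup>j\<close> at a root of unity \<open>x\<close> of order 1, 3 and 9, with
  \<open>\<omega>\<^sup>2 = - 1 - \<omega>\<close> eliminated.
\<close>

definition norm1 :: "(nat \<Rightarrow> int) \<Rightarrow> int"
  where "norm1 c = (\<Sum>j<9. c j)"

definition norm3 :: "(nat \<Rightarrow> int) \<Rightarrow> int"
  where "norm3 c = eis_norm (c 0 + c 3 + c 6 - (c 2 + c 5 + c 8), c 1 + c 4 + c 7 - (c 2 + c 5 + c 8))"

definition norm9 :: "(nat \<Rightarrow> int) \<Rightarrow> int"
  where "norm9 c = eis_norm (eis_cubic (c 0 - c 6, c 3 - c 6) (c 1 - c 7, c 4 - c 7) (c 2 - c 8, c 5 - c 8))"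

definition det9 :: "(nat \<Rightarrow> int) \<Rightarrow> int"
  where "det9 c = norm1 c * norm3 c * norm9 c"

lemma lessThan_9: "{..<9::nat} = {0, 1, 2, 3, 4, 5, 6, 7, 8}"
  by auto

text \<open>Rewrite rules lowering the degree in \<open>w\<close> to at most 1; the form with
  \<open>t\<close> catches products nested to the right.\<close>

lemma cube_root_of_unity:
  assumes "w\<^sup>2 + w + 1 = (0::'a::comm_ring_1)"
  shows "w\<^sup>2 = - w - 1" and "w * w = - w - 1" and "w * (w * t) = - (w * t) - t" and "w ^ 3 = 1"
proof -
  show *: "w\<^sup>2 = - w - 1"
    using assms by (metis add.assoc add.commute add_eq_0_iff minus_add_distrib uminus_add_conv_diff)
  then show **: "w * w = - w - 1"
    by (simp add: power2_eq_square)
  have "w * (w * t) = (w * w) * t"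
    by (rule mult.assoc[symmetric])
  then show "w * (w * t) = - (w * t) - t"
    by (simp add: ** left_diff_distrib)
  show "w ^ 3 = 1"
    by (simp add: power3_eq_cube ** left_diff_distrib)
qed

lemma eis_mult:
  assumes "w\<^sup>2 + w + 1 = (0::'a::comm_ring_1)"
  shows "eis w (eis_mult x y) = eis w x * eis w y"
  by (cases x; cases y) (simp add: cube_root_of_unity[OF assms] algebra_simps)

lemma eis_add: "eis w (x + y) = eis w x + eis w y"
  by (cases x; cases y) (simp add: algebra_simps)

lemma eis_diff: "eis w (x - y) = eis w x - eis w y"
  by (cases x; cases y) (simp add: algebra_simps)

lemma eis_cubic:
  assumes w: "w\<^sup>2 + w + 1 = (0::'a::comm_ring_1)"
  shows "eis w (eis_cubic A B C)
    = eis w A ^ 3 + w * eis w B ^ 3 + w\<^sup>2 * eis w C ^ 3 - 3 * w * eis w A * eis w B * eis w C"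
proof -
  have "eis w (- 1, - 1) = w\<^sup>2"
    by (simp add: cube_root_of_unity[OF w])
  then show ?thesis
    unfolding eis_cubic_def eis_add eis_diff eis_mult[OF w] by (simp add: power3_eq_cube mult_ac)
qed

lemma eis_norm:
  assumes w: "w\<^sup>2 + w + 1 = (0::'a::comm_ring_1)"
  shows "eis w x * eis (w\<^sup>2) x = of_int (eis_norm x)"
  by (cases x) (simp add: cube_root_of_unity[OF w] algebra_simps power2_eq_square)

lemma cubic_factorization:
  fixes w :: "'a::comm_ring_1"
  assumes w: "w\<^sup>2 + w + 1 = 0"
  shows "(x + y + z) * ((x + w * y + w\<^sup>2 * z) * (x + w\<^sup>2 * y + w * z))
    = x ^ 3 + y ^ 3 + z ^ 3 - 3 * x * y * z"
proof -
  have "(x + w * y + w\<^sup>2 * z) * (x + w\<^sup>2 * y + w * z)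
    = x\<^sup>2 + y\<^sup>2 + z\<^sup>2 - x * y - x * z - y * z"
    by (simp add: cube_root_of_unity[OF w] algebra_simps power2_eq_square)
  then show ?thesis
    by (simp only:) (simp add: algebra_simps power2_eq_square power3_eq_cube)
qed

text \<open>The powers \<open>v\<close>, \<open>v ^ 4 = w * v\<close> and
  \<open>v ^ 7 = w\<^sup>2 * v\<close> all have cube \<open>w\<close>, so each sum collapses to
  \<open>A + B * u + C * u\<^sup>2\<close> with common \<open>A\<close>, \<open>B\<close>,
  \<open>C\<close>; \<open>cubic_factorization\<close> multiplies the three.\<close>

lemma ninth_conjugates:
  fixes v :: "'a::comm_ring_1"
  assumes v: "v ^ 6 + v ^ 3 + 1 = 0"
  shows "(\<Prod>i\<in>{1, 4, 7}. \<Sum>j<9. of_int (c j) * v ^ (i * j))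
    = eis (v ^ 3) (eis_cubic (c 0 - c 6, c 3 - c 6) (c 1 - c 7, c 4 - c 7) (c 2 - c 8, c 5 - c 8))"
proof -
  define w where "w = v ^ 3"
  have w: "w\<^sup>2 + w + 1 = 0"
    using v by (simp add: w_def flip: power_mult)
  have v3: "v ^ 3 = w" by (simp add: w_def)
  have w3: "w ^ 3 = 1"
    by (rule cube_root_of_unity(4)[OF w])
  define A where "A = eis w (c 0 - c 6, c 3 - c 6)"
  define B where "B = eis w (c 1 - c 7, c 4 - c 7)"
  define C where "C = eis w (c 2 - c 8, c 5 - c 8)"
  have split: "(\<Sum>j<9. of_int (c j) * u ^ j) = A + B * u + C * u\<^sup>2" if u: "u ^ 3 = w" for u
  proof -
    have p: "u ^ 4 = w * u" "u ^ 5 = w * u\<^sup>2" "u ^ 6 = w\<^sup>2" "u ^ 7 = w\<^sup>2 * u" "u ^ 8 = w\<^sup>2 * u\<^sup>2"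
      by (simp_all add: eval_nat_numeral mult_ac flip: u)
    show ?thesis
      by (simp add: lessThan_9 u p cube_root_of_unity(1)[OF w] A_def B_def C_def algebra_simps)
  qed
  have e: "v ^ 4 = w * v" "v ^ 7 = w\<^sup>2 * v"
    by (simp_all add: eval_nat_numeral mult_ac flip: v3)
  have c: "v ^ 3 = w" "(w * v) ^ 3 = w" "(w\<^sup>2 * v) ^ 3 = w"
    using power_mult[of w 3 2] by (simp_all add: power_mult_distrib v3 w3)
  have ww: "w ^ 4 = w"
    using w3 by (simp add: eval_nat_numeral)
  have "(\<Prod>i\<in>{1, 4, 7}. \<Sum>j<9. of_int (c j) * v ^ (i * j))
    = (\<Prod>i\<in>{1, 4, 7}. \<Sum>j<9. of_int (c j) * (v ^ i) ^ j)"
    by (simp add: power_mult)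
  also have "\<dots> = (A + B * v + C * v\<^sup>2) * ((A + w * (B * v) + w\<^sup>2 * (C * v\<^sup>2))
      * (A + w\<^sup>2 * (B * v) + w * (C * v\<^sup>2)))"
    by (simp add: e split[OF c(1)] split[OF c(2)] split[OF c(3)])
      (simp add: ww power_mult_distrib mult_ac)
  also have "\<dots> = A ^ 3 + w * B ^ 3 + w\<^sup>2 * C ^ 3 - 3 * w * A * B * C"
  proof -
    have "(v\<^sup>2) ^ 3 = w\<^sup>2" "v * v\<^sup>2 = w"
      by (simp_all add: eval_nat_numeral mult_ac flip: v3)
    moreover have "3 * A * (B * v) * (C * v\<^sup>2) = 3 * (v * v\<^sup>2) * A * B * C"
      by (simp only: mult_ac)
    ultimately show ?thesis
      unfolding cubic_factorization[OF w] by (simp only: power_mult_distrib v3 mult.commute)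
  qed
  also have "\<dots> = eis w (eis_cubic (c 0 - c 6, c 3 - c 6) (c 1 - c 7, c 4 - c 7) (c 2 - c 8, c 5 - c 8))"
    unfolding eis_cubic[OF w] A_def B_def C_def ..
  finally show ?thesis by (simp add: w_def)
qed

text \<open>The exponents are grouped by the order of \<open>v ^ i\<close>: 0, then 3 and 6, then
  the units modulo 9. The units split into 1, 4, 7 and their doubles, whose product is the same
  expression with \<open>v\<^sup>2\<close> for \<open>v\<close>.\<close>

lemma prod_ninth_roots:
  fixes v :: "'a::comm_ring_1"
  assumes v: "v ^ 6 + v ^ 3 + 1 = 0"
  shows "(\<Prod>i<9. \<Sum>j<9. of_int (c j) * v ^ (i * j)) = of_int (det9 c)"
proof -
  define F where "F i = (\<Sum>j<9. of_int (c j) * v ^ (i * j))" for i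
  have w: "(v ^ 3)\<^sup>2 + v ^ 3 + 1 = 0"
    using v by (simp flip: power_mult)
  have v9: "v ^ 9 = 1"
    using cube_root_of_unity(4)[OF w] by (simp flip: power_mult)
  have "v ^ 12 = v ^ 9 * v ^ 3"
    by (simp flip: power_add)
  then have v': "(v\<^sup>2) ^ 6 + (v\<^sup>2) ^ 3 + 1 = 0"
    using v v9 by (simp add: ac_simps flip: power_mult)
  have F0: "F 0 = of_int (norm1 c)"
    by (simp add: F_def norm1_def)
  have F36: "F 3 * F 6 = of_int (norm3 c)"
  proof -
    define x where "x = (c 0 + c 3 + c 6 - (c 2 + c 5 + c 8), c 1 + c 4 + c 7 - (c 2 + c 5 + c 8))"
    have *: "(\<Sum>j<9. of_int (c j) * u ^ j) = eis u x" if "u\<^sup>2 + u + 1 = 0" for u :: 'a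
    proof -
      have p: "u ^ 3 = 1" "u ^ 4 = u" "u ^ 5 = u\<^sup>2" "u ^ 6 = 1" "u ^ 7 = u" "u ^ 8 = u\<^sup>2"
        using cube_root_of_unity(4)[OF that] by (simp_all add: eval_nat_numeral)
      show ?thesis
        by (simp add: lessThan_9 p cube_root_of_unity(1)[OF that] x_def algebra_simps)
    qed
    have "(v ^ 6)\<^sup>2 + v ^ 6 + 1 = 0"
      using v' by (simp flip: power_mult)
    then have "F 3 = eis (v ^ 3) x" "F 6 = eis (v ^ 6) x"
      using *[of "v ^ 3"] *[of "v ^ 6"] w by (simp_all add: F_def power_mult)
    moreover have "v ^ 6 = (v ^ 3)\<^sup>2"
      by (simp flip: power_mult)
    ultimately show ?thesis
      by (simp only: eis_norm[OF w] norm3_def x_def)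
  qed
  have F9: "(\<Prod>i\<in>{1, 4, 7}. F i) * (\<Prod>i\<in>{2, 5, 8}. F i) = of_int (norm9 c)"
  proof -
    \<comment> \<open>Doubling sends 1, 4, 7 to 2, 8, 14, and 14 is 5 modulo 9.\<close>
    have "F (2 * 7) = F 5"
    proof -
      have "v ^ (14 * j) = v ^ (5 * j)" for j
      proof -
        have "v ^ (14 * j) = (v ^ 9 * v ^ 5) ^ j"
          by (simp add: power_mult flip: power_add)
        then show ?thesis
          by (simp add: v9 power_mult)
      qed
      then show ?thesis
        by (simp add: F_def)
    qed
    then have "(\<Prod>i\<in>{2, 5, 8}. F i) = (\<Prod>i\<in>{1, 4, 7}. F (2 * i))"
      by (simp add: mult.commute)
    also have "\<dots> = (\<Prod>i\<in>{1, 4, 7}. \<Sum>j<9. of_int (c j) * (v\<^sup>2) ^ (i * j))"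
      by (simp only: F_def power_mult)
    also have "\<dots> = eis ((v\<^sup>2) ^ 3)
        (eis_cubic (c 0 - c 6, c 3 - c 6) (c 1 - c 7, c 4 - c 7) (c 2 - c 8, c 5 - c 8))"
      by (rule ninth_conjugates[OF v'])
    finally have "(\<Prod>i\<in>{2, 5, 8}. F i) = eis ((v ^ 3)\<^sup>2)
        (eis_cubic (c 0 - c 6, c 3 - c 6) (c 1 - c 7, c 4 - c 7) (c 2 - c 8, c 5 - c 8))"
      by (simp flip: power_mult)
    then show ?thesis
      using ninth_conjugates[OF v, of c, folded F_def] by (simp only: eis_norm[OF w] norm9_def)
  qed
  have "(\<Prod>i<9. F i) = F 0 * (F 3 * F 6) * ((\<Prod>i\<in>{1, 4, 7}. F i) * (\<Prod>i\<in>{2, 5, 8}. F i))"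
    by (simp add: lessThan_9 mult_ac)
  then show ?thesis
    unfolding F0 F36 F9 by (simp add: F_def det9_def)
qed

section \<open>Congruences modulo 3 and invariance of \<open>det9\<close>\<close>

text \<open>As \<open>\<omega> \<equiv> 1\<close> modulo the prime above 3, setting \<open>\<omega> = 1\<close> is multiplicative modulo 3.\<close>

lemma eis_norm_cong_3: "[eis_norm x = (eis 1 x)\<^sup>2] (mod 3)"
proof (cases x)
  case (Pair a b)
  have "eis_norm x = (eis 1 x)\<^sup>2 + 3 * (- a * b)"
    by (simp add: Pair power2_eq_square algebra_simps)
  then show ?thesis
    by (metis cong_def mod_mult_self2)
qed

lemma eis_mult_cong_3: "[eis 1 (eis_mult x y) = eis 1 x * (eis 1 y :: int)] (mod 3)"
proof (cases x; cases y)
  fix a b c d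
  assume xy: "x = (a, b)" "y = (c, d)"
  have "eis 1 (eis_mult x y) = eis 1 x * (eis 1 y :: int) + 3 * (- b * d)"
    by (simp add: xy algebra_simps)
  then show ?thesis
    by (metis cong_def mod_mult_self2)
qed

text \<open>The coefficients \<open>(0, 1)\<close> and \<open>(- 1, - 1)\<close> are sent to 1 and
  -2, both 1 modulo 3, while \<open>(0, 3)\<close> is sent to 0.\<close>

lemma eis_cubic_cong_3:
  "[eis 1 (eis_cubic A B C) = eis 1 A ^ 3 + eis 1 B ^ 3 + eis 1 C ^ (3::nat)] (mod (3::int))"
proof -
  let ?e = "eis (1::int)"
  have cube: "[?e (eis_mult X (eis_mult X X)) = ?e X ^ 3] (mod 3)" for X
    unfolding power3_eq_cube mult.assoc
    by (intro cong_trans[OF eis_mult_cong_3] cong_mult cong_refl eis_mult_cong_3)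
  have unit: "[?e (eis_mult (0, 1) X) = ?e X] (mod 3)" "[?e (eis_mult (- 1, - 1) X) = ?e X] (mod 3)" 
    "[?e (eis_mult (0, 3) X) = 0] (mod 3)" for X
    by (cases X; simp add: cong_iff_dvd_diff; presburger)+
  have "[?e (eis_cubic A B C) = ?e A ^ 3 + ?e B ^ 3 + ?e C ^ 3 - 0] (mod 3)"
    unfolding eis_cubic_def eis_add eis_diff
    by (intro cong_add cong_diff cube unit(3) cong_trans[OF unit(1) cube] cong_trans[OF unit(2) cube])
  then show ?thesis by simp
qed

lemma cube_cong_3: "[(x::int) ^ 3 = x] (mod 3)"
proof -
  have "x mod 3 = 0 \<or> x mod 3 = 1 \<or> x mod 3 = 2" by auto
  then have "x ^ 3 mod 3 = x mod 3"
    by (auto simp flip: power_mod[of x])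
  then show ?thesis by (simp add: cong_def)
qed

lemma norm3_cong_3: "[norm3 c = (norm1 c)\<^sup>2] (mod 3)"
proof -
  let ?x = "(c 0 + c 3 + c 6 - (c 2 + c 5 + c 8), c 1 + c 4 + c 7 - (c 2 + c 5 + c 8))"
  \<comment> \<open>The two sides differ by \<open>3 * (c 2 + c 5 + c 8)\<close>.\<close>
  have "[eis 1 ?x = norm1 c] (mod 3)"
    by (simp add: norm1_def lessThan_9 cong_iff_dvd_diff)
  then show ?thesis
    unfolding norm3_def by (intro cong_trans[OF eis_norm_cong_3] cong_pow)
qed

lemma norm9_cong_3: "[norm9 c = (norm1 c)\<^sup>2] (mod 3)"
proof -
  let ?A = "(c 0 - c 6, c 3 - c 6)" and ?B = "(c 1 - c 7, c 4 - c 7)" and ?C = "(c 2 - c 8, c 5 - c 8)"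
  let ?e = "eis (1::int)"
  have "[?e ?A ^ 3 + ?e ?B ^ 3 + ?e ?C ^ 3 = ?e ?A + ?e ?B + ?e ?C] (mod 3)"
    by (intro cong_add cube_cong_3)
  moreover have "[?e ?A + ?e ?B + ?e ?C = norm1 c] (mod 3)"
    by (simp add: norm1_def lessThan_9 cong_iff_dvd_diff)
  ultimately have "[?e (eis_cubic ?A ?B ?C) = norm1 c] (mod 3)"
    by (rule cong_trans[OF cong_trans[OF eis_cubic_cong_3]])
  then show ?thesis
    unfolding norm9_def by (intro cong_trans[OF eis_norm_cong_3] cong_pow)
qed

lemma det9_dvd_27:
  assumes "3 dvd det9 c"
  shows "27 dvd det9 c"
proof -
  have "3 dvd norm3 c \<longleftrightarrow> 3 dvd norm1 c" "3 dvd norm9 c \<longleftrightarrow> 3 dvd norm1 c"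
    using cong_dvd_iff[OF norm3_cong_3, of c] cong_dvd_iff[OF norm9_cong_3, of c]
      prime_dvd_power_iff[of "3::int" 2] by simp_all
  then have "3 dvd norm1 c" "3 dvd norm3 c" "3 dvd norm9 c"
    using assms prime_dvd_mult_iff[of "3::int"] by (auto simp: det9_def)
  then have "3 * 3 * 3 dvd det9 c"
    unfolding det9_def by (intro mult_dvd_mono)
  then show ?thesis by simp
qed

text \<open>\<open>det9\<close> is a polynomial with integer coefficients in the
  \<open>c j\<close>.\<close>

lemma det9_cong:
  assumes "\<And>j. [c j = d j] (mod m)"
  shows "[det9 c = det9 d] (mod m)"
  unfolding det9_def norm1_def norm3_def norm9_def eis_cubic_def
  by (simp, intro cong_mult cong_add cong_diff cong_pow cong_sum cong_refl assms
      cong_minus_minus_iff[THEN iffD2])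

text \<open>The added multiple of \<open>1 + x + ... + x^8\<close> vanishes at every ninth root of
  unity except 1.\<close>

lemma det9_shift: "det9 (\<lambda>j. c j + t) = (norm1 c + 9 * t) * (norm3 c * norm9 c)"
proof -
  have "norm3 (\<lambda>j. c j + t) = norm3 c"
    unfolding norm3_def by (rule arg_cong[where f = eis_norm]) simp
  then show ?thesis
    by (simp add: det9_def norm1_def norm9_def sum.distrib)
qed

section \<open>Reduction from the group of order 18 to two determinants of order 9\<close>

text \<open>
  The coefficients of \<open>F(x)\<close> and \<open>F(- x)\<close> modulo \<open>x\<^sup>9 - 1\<close>: the former takes the values
  \<open>F(\<zeta>\<^sup>k)\<close> for even \<open>k\<close>, the latter those for odd \<open>k\<close>.
\<close>

definition even_part :: "(nat \<Rightarrow> int) \<Rightarrow> nat \<Rightarrow> int"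
  where "even_part b j = b j + b (j + 9)"

definition odd_part :: "(nat \<Rightarrow> int) \<Rightarrow> nat \<Rightarrow> int"
  where "odd_part b j = (- 1) ^ j * (b j - b (j + 9))"

lemma primitive_root_of_unity:
  fixes n k :: nat
  assumes "0 < k" "k < n"
  shows "cis (2 * pi / n) ^ k \<noteq> 1"
proof -
  have "inj_on (\<lambda>k. cis (2 * pi * real k / real n)) {..<n}"
    using bij_betw_roots_unity[of n] assms by (simp add: bij_betw_def)
  then show ?thesis
    using inj_onD[of _ "{..<n}" k 0] assms by (force simp: DeMoivre mult.commute)
qed

text \<open>Since \<open>z ^ 9 = - 1\<close>, the odd powers of \<open>z\<close> are the negatives
  of the powers of \<open>z\<^sup>2\<close>, a primitive ninth root of unity.\<close>

lemma group_determinant_18: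
  fixes a :: "18 \<Rightarrow> int" and b :: "nat \<Rightarrow> int"
  assumes ab: "\<And>g. a g = b (nat (Rep_bit0 g))"
  shows "group_determinant a = det9 (even_part b) * det9 (odd_part b)"
proof -
  define r where "r = (\<lambda>g :: 18. nat (Rep_bit0 g))"
  define z where "z = cis (2 * pi / 18)"
  have z18: "z ^ 18 = 1"
    by (simp add: z_def DeMoivre)
  have primitive: "z ^ k \<noteq> 1" if "0 < k" "k < 18" for k
    using primitive_root_of_unity[OF that] by (simp add: z_def)
  have bij: "bij_betw r UNIV {..<18}"
    and hom: "[r (g + h) = r g + r h] (mod 18)" for g h
    using bit0_index[where 'n = 9] by (simp_all add: r_def)
  have "(z ^ 9)\<^sup>2 = 1"
    by (simp add: z18 flip: power_mult)
  moreover have "z ^ 9 \<noteq> 1"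
    by (rule primitive) simp_all
  ultimately have z9: "z ^ 9 = - 1"
    by (metis power2_eq_1_iff)
  have "z ^ 3 \<noteq> - 1"
  proof
    assume "z ^ 3 = - 1"
    then have "z ^ 6 = 1"
      using power_mult[of z 3 2] by simp
    then show False
      using primitive[of 6] by simp
  qed
  moreover have "(z ^ 3 + 1) * (z ^ 6 - z ^ 3 + 1) = z ^ 9 + 1"
    by (simp add: algebra_simps flip: power_add)
  ultimately have "z ^ 6 - z ^ 3 + 1 = 0"
    by (simp add: z9 add_eq_0_iff2)
  moreover have "z ^ 12 = - (z ^ 3)"
    using power_add[of z 9 3] by (simp add: z9)
  ultimately have v: "(z\<^sup>2) ^ 6 + (z\<^sup>2) ^ 3 + 1 = 0"
    by (simp flip: power_mult)

  define F where "F k = (\<Sum>j<18. of_int (b j) * z ^ (k * j))" for k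
  have F: "F k = (\<Sum>j<9. (of_int (b j) + (- 1) ^ k * of_int (b (j + 9))) * z ^ (k * j))" for k
  proof -
    have *: "z ^ (k * (j + 9)) = (- 1) ^ k * z ^ (k * j)" for j
      by (simp add: distrib_left power_add mult.commute[of k 9] power_mult z9)
    have "F k = (\<Sum>j<9. of_int (b j) * z ^ (k * j)) + (\<Sum>j<9. of_int (b (j + 9)) * z ^ (k * (j + 9)))"
      unfolding F_def using sum.nat_group[of "\<lambda>j. of_int (b j) * z ^ (k * j)" 9 2]
        sum.shift_bounds_nat_ivl[of "\<lambda>j. of_int (b j) * z ^ (k * j)" 0 9 9]
      by (simp add: numeral_2_eq_2 atLeast0LessThan)
    then show ?thesis
      unfolding * by (simp add: sum.distrib algebra_simps)
  qed
  have F_even: "F (2 * i) = (\<Sum>j<9. of_int (even_part b j) * (z\<^sup>2) ^ (i * j))" for i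
    by (simp add: F even_part_def mult.assoc flip: power_mult)
  have F_odd: "F (2 * i + 9) = (\<Sum>j<9. of_int (odd_part b j) * (z\<^sup>2) ^ (i * j))" for i
  proof -
    have "z ^ ((2 * i + 9) * j) = (z ^ 9) ^ j * (z\<^sup>2) ^ (i * j)" for j
    proof -
      have "(2 * i + 9) * j = 9 * j + 2 * (i * j)"
        by (simp add: distrib_right)
      then show ?thesis
        by (simp only: power_add power_mult)
    qed
    then show ?thesis
      unfolding F by (simp add: odd_part_def z9 mult_ac)
  qed
  have F_periodic: "F (k + 18) = F k" for k
    by (simp add: F_def distrib_right power_add power_mult z18)
  \<comment> \<open>For \<open>i < 9\<close> the exponents \<open>2 * i + 9\<close> run from 9 to
    25; those above 17 wrap around to 1, 3, 5, 7.\<close>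
  have "F 19 = F 1" "F 21 = F 3" "F 23 = F 5" "F 25 = F 7"
    using F_periodic[of 1] F_periodic[of 3] F_periodic[of 5] F_periodic[of 7] by simp_all
  then have odd: "(\<Prod>i<9. F (2 * i + 1)) = (\<Prod>i<9. F (2 * i + 9))"
    by (simp add: lessThan_9 mult_ac)
  have "complex_of_int (group_determinant a) = (\<Prod>k<18. \<Sum>g\<in>UNIV. of_int (a g) * z ^ (k * r g))"
    by (rule group_determinant_cyclic[OF bij hom z18 primitive])
  also have "\<dots> = (\<Prod>k<18. F k)"
    unfolding F_def using sum.reindex_bij_betw[OF bij, of "\<lambda>j. of_int (b j) * z ^ (k * j)" for k]
    by (simp add: ab r_def)
  also have "\<dots> = (\<Prod>i<9. F (2 * i) * F (2 * i + 1))"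
    using prod.nat_group[of F 2 9] by (simp add: numeral_2_eq_2 mult.commute)
  also have "\<dots> = (\<Prod>i<9. F (2 * i)) * (\<Prod>i<9. F (2 * i + 9))"
    by (simp only: prod.distrib odd)
  also have "\<dots> = complex_of_int (det9 (even_part b) * det9 (odd_part b))"
    unfolding F_even F_odd prod_ninth_roots[OF v] by simp
  finally show ?thesis
    by (simp only: of_int_eq_iff)
qed

lemma integer_group_determinants_18:
  "integer_group_determinants TYPE(18) = range (\<lambda>b. det9 (even_part b) * det9 (odd_part b))"
proof (intro equalityI subsetI)
  fix D assume "D \<in> integer_group_determinants TYPE(18)"
  then obtain a :: "18 \<Rightarrow> int" where a: "D = group_determinant a"
    by (auto simp: integer_group_determinants_def)
  have "a g = a (Abs_bit0 (int (nat (Rep_bit0 g))))" for g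
    using type_definition.Rep[OF type_definition_bit0, of g] by (simp add: bit0.Rep_inverse)
  then show "D \<in> range (\<lambda>b. det9 (even_part b) * det9 (odd_part b))"
    unfolding a by (subst group_determinant_18[of a "\<lambda>j. a (Abs_bit0 (int j))"]) auto
next
  fix D assume "D \<in> range (\<lambda>b. det9 (even_part b) * det9 (odd_part b))"
  then obtain b where b: "D = det9 (even_part b) * det9 (odd_part b)"
    by auto
  have "D = group_determinant (\<lambda>g::18. b (nat (Rep_bit0 g)))"
    unfolding b by (rule group_determinant_18[symmetric]) simp
  then show "D \<in> integer_group_determinants TYPE(18)"
    by (simp add: integer_group_determinants_def)
qed

section \<open>Realization of the claimed values\<close>

text \<open>Adding \<open>t\<close> to all 18 coefficients changes only the value at
  \<open>x = 1\<close>, by \<open>18 * t\<close>.\<close>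

lemma determinant_shift:
  "(norm1 (even_part b) + 18 * t) * (norm3 (even_part b) * norm9 (even_part b)) * det9 (odd_part b)
    \<in> integer_group_determinants TYPE(18)"
proof -
  have "even_part (\<lambda>j. b j + t) = (\<lambda>j. even_part b j + 2 * t)"
    "odd_part (\<lambda>j. b j + t) = odd_part b"
    by (simp_all add: even_part_def odd_part_def fun_eq_iff)
  then have "(norm1 (even_part b) + 18 * t) * (norm3 (even_part b) * norm9 (even_part b)) * det9 (odd_part b)
      = det9 (even_part (\<lambda>j. b j + t)) * det9 (odd_part (\<lambda>j. b j + t))"
    by (simp add: det9_shift)
  then show ?thesis
    unfolding integer_group_determinants_18 by blast
qed

lemmas compute_determinant =
  det9_def norm1_def norm3_def norm9_def eis_cubic_def even_part_def odd_part_def lessThan_9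

lemma determinant_coprime_6:
  assumes "k \<in> {1, 5, 7, 11, 13, 17::nat}"
  shows "int k + 18 * t \<in> integer_group_determinants TYPE(18)"
proof -
  \<comment> \<open>\<open>(x\<^sup>k - 1) / (x - 1)\<close>, a unit at every root of unity but 1\<close>
  define b :: "nat \<Rightarrow> int" where "b j = of_bool (j < k)" for j
  have "norm1 (even_part b) = int k \<and> norm3 (even_part b) = 1 \<and> norm9 (even_part b) = 1
      \<and> det9 (odd_part b) = 1"
    using assms by (elim insertE emptyE) (simp_all add: compute_determinant b_def)
  then show ?thesis
    using determinant_shift[of b t] by simp
qed

lemma determinant_4:
  assumes "k \<in> {1, 5, 7, 11, 13, 17::nat}"
  shows "4 * (int k + 9 * t) \<in> integer_group_determinants TYPE(18)"
proof -
  \<comment> \<open>\<open>(x\<^sup>2 + 1) (x\<^sup>k - 1) / (x - 1)\<close>\<close>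
  define b :: "nat \<Rightarrow> int" where "b j = of_bool (j < k) + of_bool ((j + 16) mod 18 < k)" for j
  \<comment> \<open>The factor \<open>x^2 + 1\<close> is 2 at \<open>x = 1\<close> and
    \<open>x = -1\<close>, and a unit at the other eighteenth roots of unity.\<close>
  have "norm1 (even_part b) = 2 * int k \<and> norm3 (even_part b) = 1 \<and> norm9 (even_part b) = 1
      \<and> det9 (odd_part b) = 2"
    using assms by (elim insertE emptyE) (simp_all add: compute_determinant b_def)
  then show ?thesis
    using determinant_shift[of b t] by (simp add: algebra_simps)
qed

lemma determinant_81: "81 * (2 * t + 1) \<in> integer_group_determinants TYPE(18)"
proof -
  \<comment> \<open>chosen so that, with \<open>\<Phi> = 1 + x + \<dots> + x\<^sup>8\<close>, the even part is \<open>1 - x\<^sup>5 + \<Phi>\<close>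
    and the odd part is the unit \<open>(1 + x) (1 + x + \<dots> + x\<^sup>4) - \<Phi>\<close>\<close>
  define b :: "nat \<Rightarrow> int" where
    "b j = [1, 0, 1, 0, 1, 0, 0, 1, 0, 1, 1, 0, 1, 0, 0, 1, 0, 1] ! j" for j
  \<comment> \<open>At 1 only \<Phi> contributes to the even part; at the other ninth roots only
    \<open>1 - x^5\<close> does, with norm 3 for each order. The shift gives
    \<open>(9 + 18 * t) * 3 * 3\<close>.\<close>
  have "norm1 (even_part b) = 9" "norm3 (even_part b) = 3" "norm9 (even_part b) = 3"
    "det9 (odd_part b) = 1"
    by (simp_all add: compute_determinant b_def)
  then show ?thesis
    using determinant_shift[of b t] by (simp add: algebra_simps)
qed

text \<open>The element is \<open>1 - x\<close>, so its value at 1 is 0 and the shift contributes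
  \<open>18 * t\<close>. The odd part is \<open>1 + x\<close>, which is 2 at 1 and a unit at the
  other ninth roots.\<close>

lemma determinant_324: "324 * t \<in> integer_group_determinants TYPE(18)"
proof -
  define b :: "nat \<Rightarrow> int" where "b j = of_bool (j = 0) - of_bool (j = 1)" for j
  have "norm1 (even_part b) = 0" "norm3 (even_part b) = 3" "norm9 (even_part b) = 3"
    "det9 (odd_part b) = 2"
    by (simp_all add: compute_determinant b_def)
  then show ?thesis
    using determinant_shift[of b t] by simp
qed

section \<open>Divisibility constraints and the classification\<close>

lemma determinant_18_dvd:
  assumes "D \<in> integer_group_determinants TYPE(18)"
  shows "2 dvd D \<Longrightarrow> 4 dvd D" and "3 dvd D \<Longrightarrow> 27 dvd D"
proof -
  obtain b where D: "D = det9 (even_part b) * det9 (odd_part b)"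
    using assms by (auto simp: integer_group_determinants_18)
  have "[even_part b j = odd_part b j] (mod 2)" for j
    by (simp add: even_part_def odd_part_def cong_iff_dvd_diff)
  then have "[det9 (even_part b) = det9 (odd_part b)] (mod 2)"
    by (rule det9_cong)
  then have "2 dvd det9 (even_part b) \<longleftrightarrow> 2 dvd det9 (odd_part b)"
    by (rule cong_dvd_iff)
  then show "4 dvd D" if "2 dvd D"
    using that mult_dvd_mono[of 2 "det9 (even_part b)" 2 "det9 (odd_part b)"]
    by (auto simp: D)
  show "27 dvd D" if "3 dvd D"
    using that det9_dvd_27 prime_dvd_mult_iff[of "3::int"] by (auto simp: D)
qed

theorem theorem3:
  fixes D :: int
  assumes "\<not> (\<exists>m::int. D = 3 ^ 3 * m \<and> \<not> 3 dvd m)"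
  shows "D \<in> integer_group_determinants TYPE(18) \<longleftrightarrow>
      (\<exists>m::int. D = m \<and> gcd m 6 = 1) \<or>
      (\<exists>m::int. D = 2 ^ 2 * m \<and> gcd m 3 = 1) \<or>
      (\<exists>m::int. D = 3 ^ 4 * (2 * m + 1)) \<or>
      (\<exists>m::int. D = 2 ^ 2 * 3 ^ 4 * m)"
    (is "_ \<longleftrightarrow> ?rhs")
proof
  have gcd_prime: "gcd m p = 1 \<longleftrightarrow> \<not> p dvd m" if "prime p" for m p :: int
    using that prime_imp_coprime[of p m] not_prime_unit[of p]
    by (auto simp: coprime_iff_gcd_eq_1 gcd.commute gcd_proj2_iff)
  have gcd3: "gcd m 3 = 1 \<longleftrightarrow> \<not> 3 dvd m" for m :: int
    by (rule gcd_prime) simp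
  have gcd6: "gcd m 6 = 1 \<longleftrightarrow> \<not> 2 dvd m \<and> \<not> 3 dvd m" for m :: int
    using coprime_mult_right_iff[of m 2 3] gcd3[of m] gcd_prime[of 2 m]
    by (simp add: coprime_iff_gcd_eq_1)
  show ?rhs if D: "D \<in> integer_group_determinants TYPE(18)"
  proof (cases "3 dvd D")
    case True
    then obtain m where m: "D = 27 * m"
      using determinant_18_dvd(2)[OF D] by blast
    \<comment> \<open>The hypothesis excludes exactly three factors 3, so 81 divides
      \<open>D\<close>.\<close>
    then obtain l where l: "m = 3 * l"
      using assms by auto
    show ?thesis
    proof (cases "2 dvd D")
      case True
      then have "4 dvd 81 * l"
        using determinant_18_dvd(1)[OF D] by (simp add: m l)
      then have "4 dvd l" by presburger
      then show ?thesis
        using m l by auto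
    next
      case False
      then have "odd l" by (simp add: m l)
      then show ?thesis
        using m l by (auto elim!: oddE)
    qed
  next
    case False
    show ?thesis
    proof (cases "2 dvd D")
      case True
      then obtain m where "D = 4 * m"
        using determinant_18_dvd(1)[OF D] by blast
      then show ?thesis
        using False gcd3 by auto
    next
      case False
      then show ?thesis
        using \<open>\<not> 3 dvd D\<close> gcd6 by blast
    qed
  qed
  assume ?rhs
  then consider "\<not> 2 dvd D" "\<not> 3 dvd D" | m where "D = 4 * m" "\<not> 3 dvd m"
    | m where "D = 81 * (2 * m + 1)" | m where "D = 324 * m"
    by (auto simp: gcd3 gcd6)
  then show "D \<in> integer_group_determinants TYPE(18)"
  proof cases
    case 1
    then have "D mod 18 \<in> {1, 5, 7, 11, 13, 17}"
      by (simp; presburger)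
    then have "D mod 18 + 18 * (D div 18) \<in> integer_group_determinants TYPE(18)"
      using determinant_coprime_6[of "nat (D mod 18)" "D div 18"] by auto
    then show ?thesis by simp
  next
    case (2 m)
    then have "m mod 9 \<in> {1, 2, 4, 5, 7, 8}"
      by (simp; presburger)
    \<comment> \<open>The values of \<open>k\<close> allowed in \<open>determinant_4\<close> cover
      all units modulo 9: 11, 13 and 17 stand for 2, 4 and 8.\<close>
    then obtain k where k: "k \<in> {1, 5, 7, 11, 13, 17::nat}" "m mod 9 = int k mod 9"
    proof -
      assume a1: "\<And>k. k \<in> {1, 5, 7, 11, 13, 17} \<Longrightarrow> m mod 9 = int k mod 9 \<Longrightarrow> thesis"
      show thesis
        using \<open>m mod 9 \<in> _\<close> a1[of 1] a1[of 5] a1[of 7] a1[of 11] a1[of 13] a1[of 17] by auto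
    qed
    then have "9 dvd m - int k"
      by (simp add: mod_eq_dvd_iff)
    then obtain t where "m = int k + 9 * t"
      by (metis add.commute diff_add_cancel dvdE)
    then show ?thesis
      using determinant_4[OF k(1)] 2 by simp
  next
    case 3
    then show ?thesis
      by (simp only: determinant_81)
  next
    case 4
    then show ?thesis
      by (simp only: determinant_324)
  qed
qed

end
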